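(* Let $k,g,u,c$ be positive integers with $c\ge 2$, and let ${\cal D}$ be a $k$-GDD of type $g^u$ with $3\le k\le u$. Then there exists a block-equitable $c$-colouring of ${\cal D}$ if and only if at least one of the following holds: (i) $u\le c\le ug$; (ii) $k=u$; (iii) $k=u-1$ and $c$ divides $u$.
   Context: A group divisible design (GDD) is a triple $(V,{\cal G},{\cal B})$ where $V$ is a finite set of points, ${\cal G}$ is a partition of $V$ into groups, and ${\cal B}$ is a collection of subsets of $V$ (blocks) such that every pair of distinct points lies either in exactly one block or in exactly one group, but not both. A $k$-GDD of type $g^u$ is a GDD with all blocks of size $k$ and exactly $u$ groups, each of size $g$. A $c$-colouring of a design with point set $V$ is a function $f:V\to{\cal C}$ where $|{\cal C}|=c$; its colour classes are $F(\gamma)=\{x\in V: f(x)=\gamma\}$. A $c$-colouring is block-equitable if $\lfloor k/c\rfloor\le |B\cap F(\gamma)|\le\lceil k/c\rceil$ for every colour $\gamma\in{\cal C}$ and every block $B$.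
   Formalization: The formal theorem adds the hypothesis c ≤ ug (no more colours than points); without it the claim fails, e.g. for the Fano plane (k=3, g=1, u=7) with c=8, where an injective colouring is block-equitable but (i)–(iii) all fail. *)

theory Defs
  imports Complex_Main "HOL-Library.Disjoint_Sets"
begin

text \<open>The blocks form a set: a block with at least two points cannot be repeated, since its pairs
  of points would then lie in two blocks. ``But not both'' is read as: a pair inside a group lies
  in no block at all, and a pair inside a block lies in no group.\<close>

definition group_divisible_design :: "'a set \<Rightarrow> 'a set set \<Rightarrow> 'a set set \<Rightarrow> bool" where
  "group_divisible_design V \<G> \<B> \<longleftrightarrow>
     finite V \<and> partition_on V \<G> \<and> (\<forall>B\<in>\<B>. B \<subseteq> V) \<and>
     (\<forall>x\<in>V. \<forall>y\<in>V. x \<noteq> y \<longrightarrow>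
        ((\<exists>!B. B \<in> \<B> \<and> {x, y} \<subseteq> B) \<and> \<not> (\<exists>G\<in>\<G>. {x, y} \<subseteq> G)) \<or>
        ((\<exists>!G. G \<in> \<G> \<and> {x, y} \<subseteq> G) \<and> \<not> (\<exists>B\<in>\<B>. {x, y} \<subseteq> B)))"

definition k_GDD_of_type ::
    "nat \<Rightarrow> nat \<Rightarrow> nat \<Rightarrow> 'a set \<Rightarrow> 'a set set \<Rightarrow> 'a set set \<Rightarrow> bool" where
  "k_GDD_of_type k g u V \<G> \<B> \<longleftrightarrow>
     group_divisible_design V \<G> \<B> \<and> (\<forall>B\<in>\<B>. card B = k) \<and>
     card \<G> = u \<and> (\<forall>G\<in>\<G>. card G = g)"

text \<open>A colour may have an empty colour class.\<close>

definition colouring :: "nat \<Rightarrow> 'a set \<Rightarrow> 'c set \<Rightarrow> ('a \<Rightarrow> 'c) \<Rightarrow> bool" where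
  "colouring c V C f \<longleftrightarrow> finite C \<and> card C = c \<and> (\<forall>x\<in>V. f x \<in> C)"

definition colour_class :: "'a set \<Rightarrow> ('a \<Rightarrow> 'c) \<Rightarrow> 'c \<Rightarrow> 'a set" where
  "colour_class V f \<gamma> = {x \<in> V. f x = \<gamma>}"

definition block_equitable_colouring ::
    "nat \<Rightarrow> nat \<Rightarrow> 'a set \<Rightarrow> 'a set set \<Rightarrow> 'c set \<Rightarrow> ('a \<Rightarrow> 'c) \<Rightarrow> bool" where
  "block_equitable_colouring k c V \<B> C f \<longleftrightarrow>
     colouring c V C f \<and>
     (\<forall>\<gamma>\<in>C. \<forall>B\<in>\<B>.
        \<lfloor>real k / real c\<rfloor> \<le> int (card (B \<inter> colour_class V f \<gamma>)) \<and>
        int (card (B \<inter> colour_class V f \<gamma>)) \<le> \<lceil>real k / real c\<rceil>)"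

text \<open>Colour sets are sets of natural numbers, which loses nothing: only the number of
  colours matters.\<close>

definition has_block_equitable_colouring ::
    "nat \<Rightarrow> nat \<Rightarrow> 'a set \<Rightarrow> 'a set set \<Rightarrow> bool" where
  "has_block_equitable_colouring k c V \<B> \<longleftrightarrow>
     (\<exists>(C :: nat set) f. block_equitable_colouring k c V \<B> C f)"

end

theory Submission imports Defs begin

text \<open>Let every block meet \<open>F\<close> in \<open>q\<close> or \<open>q + 1\<close> points, where \<open>1 \<le> q\<close>, \<open>q + 1 < k < u\<close>, and
  put \<open>w = |F| - q r\<close> with \<open>r\<close> the replication number. Counting along the blocks through a point
  shows that a group which meets \<open>F\<close> without being contained in it meets it in exactly \<open>w\<close> points.
  Counting pairs of points of \<open>F\<close> in blocks then shows that the points of \<open>F\<close> lying in such groups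
  number less than \<open>w\<close>, so there are none: \<open>F\<close> is a union of groups. The same count gives
  \<open>w (g - w) = E\<close> for a constant \<open>E > 0\<close> (\<open>excess q\<close> below), hence \<open>q r < |F| < q r + g\<close>, and so
  \<open>F\<close> consists of a number \<open>m\<close> of groups that depends on the parameters only.

  The classes of a block-equitable colouring with \<open>c \<le> k < u\<close> are such sets for \<open>q = k div c\<close>, so
  \<open>u = c m\<close>, and \<open>w (g - w) = E\<close> forces \<open>k = u - 1\<close>. If \<open>k < c\<close>, each colour lies in a single group,
  so \<open>u \<le> c\<close>. Conversely, number the groups and colour them by their number modulo \<open>c\<close>.\<close>

section \<open>Points, groups and blocks of the design\<close>

locale gdd =
  fixes k g u :: nat and V :: "'a set" and \<G> \<B> :: "'a set set"
  assumes design: "k_GDD_of_type k g u V \<G> \<B>"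
    and k_ge_3: "3 \<le> k" and g_pos: "0 < g"
begin

text \<open>For a point of \<open>V\<close> the collection is a singleton, so its union is the one
  group through \<open>x\<close>.\<close>

definition group_of :: "'a \<Rightarrow> 'a set" where
  "group_of x = \<Union>{G \<in> \<G>. x \<in> G}"

text \<open>The replication number, expressed by the parameters so that it is visibly independent of
  the point; by \<open>replication\<close> the division is exact once the design has a
  point.\<close>

definition r :: nat where "r = g * (u - 1) div (k - 1)"

lemma finite_V [simp]: "finite V"
  and partition: "partition_on V \<G>"
  and block_subset: "B \<in> \<B> \<Longrightarrow> B \<subseteq> V"
  and card_block: "B \<in> \<B> \<Longrightarrow> card B = k"
  and card_groups: "card \<G> = u"
  and card_group: "G \<in> \<G> \<Longrightarrow> card G = g"
  using design unfolding k_GDD_of_type_def group_divisible_design_def by auto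

lemma pair_cases:
  assumes "x \<in> V" "y \<in> V" "x \<noteq> y"
  shows "((\<exists>!B. B \<in> \<B> \<and> {x, y} \<subseteq> B) \<and> \<not> (\<exists>G\<in>\<G>. {x, y} \<subseteq> G)) \<or>
    ((\<exists>!G. G \<in> \<G> \<and> {x, y} \<subseteq> G) \<and> \<not> (\<exists>B\<in>\<B>. {x, y} \<subseteq> B))"
proof -
  have "\<forall>x\<in>V. \<forall>y\<in>V. x \<noteq> y \<longrightarrow>
      ((\<exists>!B. B \<in> \<B> \<and> {x, y} \<subseteq> B) \<and> \<not> (\<exists>G\<in>\<G>. {x, y} \<subseteq> G)) \<or>
      ((\<exists>!G. G \<in> \<G> \<and> {x, y} \<subseteq> G) \<and> \<not> (\<exists>B\<in>\<B>. {x, y} \<subseteq> B))"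
    using design unfolding k_GDD_of_type_def group_divisible_design_def by (elim conjE)
  from mp[OF bspec[OF bspec[OF this assms(1)] assms(2)] assms(3)] show ?thesis .
qed

lemma finite_groups [simp]: "finite \<G>"
  using finite_elements[OF finite_V partition] .

lemma finite_blocks [simp]: "finite \<B>"
  using block_subset by (intro finite_subset[of \<B> "Pow V"]) auto

lemma group_subset: "G \<in> \<G> \<Longrightarrow> G \<subseteq> V"
  using partition by (auto simp: partition_on_def)

lemma group_of_eq: "G \<in> \<G> \<Longrightarrow> x \<in> G \<Longrightarrow> group_of x = G"
  using partition unfolding group_of_def partition_on_def disjoint_def by blast

lemma group_of_in_groups: "x \<in> V \<Longrightarrow> group_of x \<in> \<G>"
  and mem_group_of: "x \<in> V \<Longrightarrow> x \<in> group_of x"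
proof -
  assume "x \<in> V"
  then obtain G where "G \<in> \<G>" "x \<in> G"
    using partition by (auto simp: partition_on_def)
  then show "group_of x \<in> \<G>" "x \<in> group_of x"
    using group_of_eq by auto
qed

lemma card_union_of_groups:
  assumes "\<H> \<subseteq> \<G>"
  shows "card (\<Union>\<H>) = g * card \<H>"
proof -
  have "pairwise disjnt \<H>"
    using assms partition by (auto simp: partition_on_def disjoint_def pairwise_def disjnt_def)
  moreover have "finite G" if "G \<in> \<H>" for G
    using that assms group_subset finite_subset[OF _ finite_V] by blast
  ultimately have "card (\<Union>\<H>) = (\<Sum>G\<in>\<H>. card G)"
    by (rule card_Union_disjoint)
  also have "\<dots> = (\<Sum>G\<in>\<H>. g)"
    using assms card_group by (intro sum.cong) auto
  finally show ?thesis by simp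
qed

lemma card_V: "card V = g * u"
  using card_union_of_groups[of \<G>] partition card_groups by (simp add: partition_on_def)

section \<open>Blocks through a point\<close>

lemma block_through:
  assumes "x \<in> V" "y \<in> V" "y \<notin> group_of x"
  shows "\<exists>!B. B \<in> \<B> \<and> {x, y} \<subseteq> B"
proof -
  have "x \<noteq> y" using assms mem_group_of by blast
  moreover have "\<not> (\<exists>G\<in>\<G>. {x, y} \<subseteq> G)" using assms group_of_eq by auto
  ultimately show ?thesis using pair_cases[of x y] assms by blast
qed

lemma block_not_mem_group_of:
  assumes "B \<in> \<B>" "x \<in> B" "y \<in> B" "x \<noteq> y"
  shows "y \<notin> group_of x"
proof
  assume y: "y \<in> group_of x"
  have V: "x \<in> V" "y \<in> V" using assms block_subset by auto
  then have "\<exists>G\<in>\<G>. {x, y} \<subseteq> G" using y group_of_in_groups mem_group_of by blast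
  moreover have "\<exists>B\<in>\<B>. {x, y} \<subseteq> B" using assms by blast
  ultimately show False using pair_cases[OF V \<open>x \<noteq> y\<close>] by blast
qed

lemma inj_on_group_of_block: "B \<in> \<B> \<Longrightarrow> inj_on group_of B"
  using block_not_mem_group_of block_subset mem_group_of unfolding inj_on_def by blast

text \<open>The blocks through \<open>x\<close>, with \<open>x\<close> removed, partition the points
  outside the group of \<open>x\<close>: such a point shares exactly one block with
  \<open>x\<close>, and no block contains a second point of that group.\<close>

lemma sum_blocks_through_point:
  assumes "x \<in> V" "S \<subseteq> V"
  shows "(\<Sum>B | B \<in> \<B> \<and> x \<in> B. card (B \<inter> S - {x})) = card (S - group_of x)"
proof -
  have "S - group_of x = (\<Union>B\<in>{B. B \<in> \<B> \<and> x \<in> B}. B \<inter> S - {x})" (is "_ = ?U")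
  proof
    show "S - group_of x \<subseteq> ?U"
    proof
      fix y assume y: "y \<in> S - group_of x"
      then obtain B where "B \<in> \<B>" "{x, y} \<subseteq> B"
        using block_through[of x y] assms by blast
      then show "y \<in> ?U" using y mem_group_of[OF assms(1)] by auto
    qed
    show "?U \<subseteq> S - group_of x"
      using block_not_mem_group_of by blast
  qed
  also have "card \<dots> = (\<Sum>B | B \<in> \<B> \<and> x \<in> B. card (B \<inter> S - {x}))"
  proof (rule card_UN_disjoint)
    show "\<forall>B\<in>{B \<in> \<B>. x \<in> B}. finite (B \<inter> S - {x})"
      using assms finite_subset[OF _ finite_V] by blast
    show "\<forall>A\<in>{B \<in> \<B>. x \<in> B}. \<forall>B\<in>{B \<in> \<B>. x \<in> B}.
        A \<noteq> B \<longrightarrow> (A \<inter> S - {x}) \<inter> (B \<inter> S - {x}) = {}"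
    proof (intro ballI impI)
      fix A B assume AB: "A \<in> {B \<in> \<B>. x \<in> B}" "B \<in> {B \<in> \<B>. x \<in> B}" "A \<noteq> B"
      show "(A \<inter> S - {x}) \<inter> (B \<inter> S - {x}) = {}"
      proof (rule ccontr)
        assume "\<not> ?thesis"
        then obtain y where y: "y \<in> A" "y \<in> B" "y \<in> S" "y \<noteq> x" by blast
        then have "y \<notin> group_of x" using block_not_mem_group_of[of A x y] AB by auto
        then show False using block_through[of x y] y AB assms by blast
      qed
    qed
  qed simp
  finally show ?thesis by simp
qed

lemma card_group_of: "x \<in> V \<Longrightarrow> card (group_of x) = g"
  using card_group group_of_in_groups by blast

lemma replication:
  assumes "x \<in> V"
  shows "card {B \<in> \<B>. x \<in> B} * (k - 1) = g * (u - 1)"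
proof -
  have "card {B \<in> \<B>. x \<in> B} * (k - 1) = (\<Sum>B | B \<in> \<B> \<and> x \<in> B. k - 1)" by simp
  also have "\<dots> = (\<Sum>B | B \<in> \<B> \<and> x \<in> B. card (B \<inter> V - {x}))"
    using block_subset card_block by (intro sum.cong) (auto simp: Int_absorb2)
  also have "\<dots> = card (V - group_of x)"
    using sum_blocks_through_point assms by blast
  also have "\<dots> = g * u - g"
    using card_V card_group_of group_subset group_of_in_groups assms
    by (subst card_Diff_subset) (auto intro: finite_subset[OF _ finite_V])
  finally show ?thesis by (simp add: diff_mult_distrib2)
qed

lemma card_blocks_through: "x \<in> V \<Longrightarrow> card {B \<in> \<B>. x \<in> B} = r"
proof -
  assume "x \<in> V"
  then have "g * (u - 1) = card {B \<in> \<B>. x \<in> B} * (k - 1)" using replication by simp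
  moreover have "k - 1 \<noteq> 0" using k_ge_3 by simp
  ultimately show ?thesis unfolding r_def by (metis nonzero_mult_div_cancel_right)
qed

section \<open>Double counting of incidences and pairs\<close>

lemma sum_blocks_swap:
  assumes "S \<subseteq> V"
  shows "(\<Sum>B\<in>\<B>. \<Sum>x\<in>B \<inter> S. h B x) = (\<Sum>x\<in>S. \<Sum>B | B \<in> \<B> \<and> x \<in> B. h B x)"
proof -
  have "finite S" using assms finite_V by (rule finite_subset)
  then have "(\<Sum>B\<in>\<B>. \<Sum>x | x \<in> S \<and> x \<in> B. h B x) = (\<Sum>x\<in>S. \<Sum>B | B \<in> \<B> \<and> x \<in> B. h B x)"
    by (intro sum.swap_restrict) auto
  moreover have "B \<inter> S = {x. x \<in> S \<and> x \<in> B}" for B by blast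
  ultimately show ?thesis by simp
qed

lemma sum_card_block_Int:
  assumes "S \<subseteq> V"
  shows "(\<Sum>B\<in>\<B>. card (B \<inter> S)) = r * card S"
proof -
  have "(\<Sum>B\<in>\<B>. card (B \<inter> S)) = (\<Sum>x\<in>S. card {B \<in> \<B>. x \<in> B})"
    using sum_blocks_swap[OF assms, of "\<lambda>_ _. 1 :: nat"] by simp
  also have "\<dots> = (\<Sum>x\<in>S. r)"
    using assms card_blocks_through by (intro sum.cong) auto
  finally show ?thesis by simp
qed

text \<open>Both sides count the ordered pairs of distinct points of \<open>S\<close> that share a
  block, on the left by the block and on the right by the first point.\<close>

lemma sum_card_block_Int_pairs:
  assumes "S \<subseteq> V"
  shows "(\<Sum>B\<in>\<B>. card (B \<inter> S) * (card (B \<inter> S) - 1)) = (\<Sum>x\<in>S. card (S - group_of x))"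
proof -
  have "(\<Sum>B\<in>\<B>. card (B \<inter> S) * (card (B \<inter> S) - 1)) = (\<Sum>B\<in>\<B>. \<Sum>x\<in>B \<inter> S. card (B \<inter> S - {x}))"
    by (intro sum.cong) auto
  also have "\<dots> = (\<Sum>x\<in>S. \<Sum>B | B \<in> \<B> \<and> x \<in> B. card (B \<inter> S - {x}))"
    by (rule sum_blocks_swap[OF assms])
  also have "\<dots> = (\<Sum>x\<in>S. card (S - group_of x))"
    using assms by (intro sum.cong refl sum_blocks_through_point) auto
  finally show ?thesis .
qed

lemma r_times: "0 < u \<Longrightarrow> r * (k - 1) = g * (u - 1)"
proof -
  assume "0 < u"
  then have "card V > 0" using card_V g_pos by simp
  then obtain x where "x \<in> V" by (metis card_gt_0_iff ex_in_conv)
  then show ?thesis using replication[of x] card_blocks_through[of x] by simp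
qed

lemma card_blocks_times: "card \<B> * k = r * (g * u)"
proof -
  have "(\<Sum>B\<in>\<B>. card (B \<inter> V)) = (\<Sum>B\<in>\<B>. k)"
    using block_subset card_block by (intro sum.cong) (auto simp: Int_absorb2)
  then show ?thesis using sum_card_block_Int[of V] card_V by simp
qed

text \<open>The constant left over by the pair count for \<open>F\<close>: with
  \<open>w = |F| - q r\<close> and \<open>A\<close> the points of \<open>F\<close> whose group lies
  in \<open>F\<close>, that count becomes \<open>(|A| - q r) (g - w) = excess q\<close>.\<close>

definition excess :: "nat \<Rightarrow> int" where
  "excess q = int (card \<B>) * (int q * (int q + 1)) - (int q * int r)\<^sup>2 - int q * int r * int g"

lemma excess_pos:
  assumes "1 \<le> q" "q + 1 < k" "k < u"
  shows "0 < excess q"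
proof -
  have r: "int r * (int k - 1) = int g * (int u - 1)"
    using arg_cong[OF r_times, of int] assms k_ge_3 by (simp add: of_nat_diff)
  have b: "int (card \<B>) * int k = int r * (int g * int u)"
    using card_blocks_times by (metis of_nat_mult)
  have "int r > 0"
  proof -
    have "int g * (int u - 1) > 0" using g_pos assms by simp
    then have "int r \<noteq> 0" using r by (metis less_irrefl mult_zero_left)
    then show ?thesis by simp
  qed
  \<comment> \<open>The factor \<open>k (k - 1)\<close> makes both parameter identities
    \<open>r\<close> and \<open>b\<close> applicable, and the result splits into positive
    factors.\<close>
  have "int k * (int k - 1) * excess q =
      (int k - 1) * ((int (card \<B>) * int k) * (int q * (int q + 1)))
      - int k * int q * int r * (int q * (int r * (int k - 1)) + (int k - 1) * int g)"
    unfolding excess_def by (simp add: algebra_simps power2_eq_square)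
  also have "\<dots> = int q * int r * int g * (int u - int k) * (int k - 1 - int q)"
    unfolding r b by (simp add: algebra_simps)
  also have "\<dots> > 0" using assms \<open>int r > 0\<close> g_pos by simp
  finally have "0 < int k * (int k - 1) * excess q" .
  moreover have "0 < int k * (int k - 1)" using k_ge_3 by simp
  ultimately show ?thesis by (simp only: zero_less_mult_pos)
qed

text \<open>At a point \<open>x\<close> of \<open>F\<close> the blocks through \<open>x\<close> contribute at most \<open>q\<close> further points of \<open>F\<close> each,
  at a point outside \<open>F\<close> at least \<open>q\<close>; so a group which meets \<open>F\<close> without being contained in it
  forces equality.\<close>

lemma card_Diff_group_of_le:
  assumes "F \<subseteq> V" "x \<in> F" "\<And>B. B \<in> \<B> \<Longrightarrow> card (B \<inter> F) \<le> q + 1"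
  shows "card (F - group_of x) \<le> q * r"
proof -
  have "x \<in> V" using assms by auto
  have "card (F - group_of x) = (\<Sum>B | B \<in> \<B> \<and> x \<in> B. card (B \<inter> F - {x}))"
    using sum_blocks_through_point[OF \<open>x \<in> V\<close> assms(1)] by simp
  also have "\<dots> \<le> (\<Sum>B | B \<in> \<B> \<and> x \<in> B. q)"
    using assms by (intro sum_mono) (auto simp: le_diff_conv)
  also have "\<dots> = q * r" using card_blocks_through[OF \<open>x \<in> V\<close>] by simp
  finally show ?thesis .
qed

lemma card_Diff_group_of_ge:
  assumes "F \<subseteq> V" "y \<in> V" "y \<notin> F" "\<And>B. B \<in> \<B> \<Longrightarrow> q \<le> card (B \<inter> F)"
  shows "q * r \<le> card (F - group_of y)"
proof -
  have "q * r = (\<Sum>B | B \<in> \<B> \<and> y \<in> B. q)" using card_blocks_through[OF assms(2)] by simp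
  also have "\<dots> \<le> (\<Sum>B | B \<in> \<B> \<and> y \<in> B. card (B \<inter> F - {y}))"
    using assms by (intro sum_mono) auto
  also have "\<dots> = card (F - group_of y)"
    by (rule sum_blocks_through_point[OF assms(2,1)])
  finally show ?thesis .
qed

section \<open>Sets that every block meets in \<open>q\<close> or \<open>q + 1\<close>
  points\<close>

context
  fixes F :: "'a set" and q :: nat
  assumes F_subset: "F \<subseteq> V"
    and lower: "\<And>B. B \<in> \<B> \<Longrightarrow> q \<le> card (B \<inter> F)"
    and upper: "\<And>B. B \<in> \<B> \<Longrightarrow> card (B \<inter> F) \<le> q + 1"
begin

lemma finite_F: "finite F"
  using F_subset finite_V finite_subset by blast

text \<open>If \<open>t\<close> is \<open>q\<close> or \<open>q + 1\<close>, then
  \<open>(t - q) (t - q - 1) = 0\<close>, so \<open>t (t - 1)\<close> equals the linear expression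
  \<open>2 q t - q (q + 1)\<close>, and the pair count reduces to the incidence count.\<close>

lemma sum_card_Diff_group_of:
  "(\<Sum>x\<in>F. int (card (F - group_of x)))
     = 2 * int q * int r * int (card F) - int (card \<B>) * (int q * (int q + 1))"
proof -
  define t where "t B = int (card (B \<inter> F))" for B
  have *: "int (card (B \<inter> F) * (card (B \<inter> F) - 1)) = 2 * int q * t B - int q * (int q + 1)"
    if "B \<in> \<B>" for B
  proof -
    have "card (B \<inter> F) = q \<or> card (B \<inter> F) = q + 1"
      using lower[OF that] upper[OF that] by linarith
    \<comment> \<open>For \<open>q = 0\<close> the intersection may be empty, where subtracting 1
      truncates; hence the case split.\<close>
    then show ?thesis
      unfolding t_def by (cases q) (auto simp: algebra_simps)
  qed
  have "(\<Sum>x\<in>F. int (card (F - group_of x))) = (\<Sum>B\<in>\<B>. int (card (B \<inter> F) * (card (B \<inter> F) - 1)))"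
    using arg_cong[OF sum_card_block_Int_pairs[OF F_subset], of int]
    unfolding of_nat_sum by (rule sym)
  also have "\<dots> = (\<Sum>B\<in>\<B>. 2 * int q * t B - int q * (int q + 1))"
    using * by (rule sum.cong[OF refl])
  also have "\<dots> = 2 * int q * (\<Sum>B\<in>\<B>. t B) - int (card \<B>) * (int q * (int q + 1))"
    by (simp add: sum_subtractf sum_distrib_left)
  also have "(\<Sum>B\<in>\<B>. t B) = int r * int (card F)"
    unfolding t_def using arg_cong[OF sum_card_block_Int[OF F_subset], of int]
    unfolding of_nat_sum of_nat_mult .
  finally show ?thesis by simp
qed

lemma group_of_subset:
  assumes "1 \<le> q" "q + 1 < k" "k < u" "x \<in> F"
  shows "group_of x \<subseteq> F"
proof (rule ccontr)
  assume not: "\<not> group_of x \<subseteq> F"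
  define A where "A = {y \<in> F. group_of y \<subseteq> F}"
  define w where "w = int (card F) - int q * int r"
  have fA: "finite A" "A \<subseteq> F" using finite_F A_def by auto
  have split: "card (F - group_of y) + card (F \<inter> group_of y) = card F" for y
    using card_Int_Diff[OF finite_F, of "group_of y"] by simp
  have outside: "card (F - group_of y) = q * r" if y: "y \<in> F" "\<not> group_of y \<subseteq> F" for y
  proof -
    obtain z where z: "z \<in> group_of y" "z \<notin> F" using y by blast
    have "group_of z = group_of y" "z \<in> V"
      using z y F_subset group_of_in_groups group_of_eq group_subset by blast+
    then have "q * r \<le> card (F - group_of y)"
      using card_Diff_group_of_ge[OF F_subset, of z q] z lower by auto
    then show ?thesis using card_Diff_group_of_le[OF F_subset, of y q] y upper by auto
  qed
  have inside: "int (card (F - group_of y)) = int (card F) - int g" if y: "y \<in> A" for y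
  proof -
    have "F \<inter> group_of y = group_of y" using y A_def by auto
    moreover have "y \<in> V" using y A_def F_subset by auto
    ultimately show ?thesis using split[of y] card_group_of by simp
  qed
  have x: "x \<in> V" using F_subset assms by auto
  have w: "int (card (F \<inter> group_of x)) = w"
    using split[of x] outside[OF assms(4) not] unfolding w_def by (simp flip: of_nat_mult)
  have "card (F \<inter> group_of x) < card (group_of x)"
    using not group_subset[OF group_of_in_groups[OF x]] finite_V
    by (intro psubset_card_mono) (blast intro: finite_subset)+
  then have "w < int g" using w card_group_of[OF x] by simp
  \<comment> \<open>A point outside \<open>A\<close> contributes exactly \<open>q r\<close> by
    \<open>outside\<close>, a point of \<open>A\<close> contributes \<open>|F| - g\<close>.\<close>
  have "(\<Sum>y\<in>F. int (card (F - group_of y)))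
      = (\<Sum>y\<in>F - A. int (card (F - group_of y))) + (\<Sum>y\<in>A. int (card (F - group_of y)))"
    using sum.subset_diff[OF fA(2) finite_F] .
  also have "(\<Sum>y\<in>F - A. int (card (F - group_of y))) = (\<Sum>y\<in>F - A. int q * int r)"
    using outside A_def by (intro sum.cong) (auto simp flip: of_nat_mult)
  also have "\<dots> = (int (card F) - int (card A)) * (int q * int r)"
    using fA finite_F by (simp add: card_Diff_subset of_nat_diff card_mono)
  also have "(\<Sum>y\<in>A. int (card (F - group_of y))) = int (card A) * (int (card F) - int g)"
    using inside by simp
  finally have "(int (card A) - int q * int r) * (int g - w) = excess q"
    using sum_card_Diff_group_of unfolding w_def excess_def
    by (simp add: algebra_simps power2_eq_square)
  then have "0 < (int (card A) - int q * int r) * (int g - w)"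
    using excess_pos[OF assms(1-3)] by simp
  then have "int (card A) > int q * int r"
    using zero_less_mult_pos2[of "int (card A) - int q * int r" "int g - w"] \<open>w < int g\<close> by simp
  \<comment> \<open>The \<open>w\<close> points of \<open>F\<close> in the group of \<open>x\<close>
    all avoid \<open>A\<close>, but \<open>F - A\<close> has fewer than \<open>|F| - q r = w\<close>
    points.\<close>
  moreover have "card (F \<inter> group_of x) \<le> card (F - A)"
  proof (rule card_mono)
    show "F \<inter> group_of x \<subseteq> F - A"
      using not group_of_eq[OF group_of_in_groups[OF x]] unfolding A_def by auto
  qed (use finite_F in auto)
  moreover have "card (F - A) = card F - card A" "card A \<le> card F"
    using fA finite_F by (simp_all add: card_Diff_subset card_mono)
  ultimately show False
    using w unfolding w_def by linarith
qed

text \<open>Now every point of \<open>F\<close> has its whole group in \<open>F\<close>, so the pair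
  count is the one with \<open>A = F\<close>, and its first factor becomes \<open>w\<close> as
  well.\<close>

lemma union_of_groups:
  assumes "1 \<le> q" "q + 1 < k" "k < u"
  shows "card F = g * card {G \<in> \<G>. G \<subseteq> F}"
    and "(int (card F) - int q * int r) * (int g - (int (card F) - int q * int r)) = excess q"
proof -
  have "F = \<Union>{G \<in> \<G>. G \<subseteq> F}"
    using group_of_subset[OF assms] group_of_in_groups mem_group_of F_subset by blast
  then show "card F = g * card {G \<in> \<G>. G \<subseteq> F}"
    using card_union_of_groups[of "{G \<in> \<G>. G \<subseteq> F}"] by auto
  have *: "int (card (F - group_of x)) = int (card F) - int g" if "x \<in> F" for x
  proof -
    have "card (group_of x) = g" using that F_subset card_group_of by blast
    moreover have "F \<inter> group_of x = group_of x" using group_of_subset[OF assms that] by blast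
    ultimately show ?thesis using card_Int_Diff[OF finite_F, of "group_of x"] by simp
  qed
  have "(\<Sum>x\<in>F. int (card (F - group_of x))) = int (card F) * (int (card F) - int g)"
    using * by simp
  then show "(int (card F) - int q * int r) * (int g - (int (card F) - int q * int r)) = excess q"
    using sum_card_Diff_group_of unfolding excess_def
    by (simp add: algebra_simps power2_eq_square)
qed

end

end

section \<open>Arithmetic of the class size and of residue classes\<close>

lemma class_size_equation_imp:
  fixes q c s k u m :: int
  assumes "1 \<le> q" "2 \<le> c" "0 \<le> s" "s < c" "k = q * c + s" "u = c * m" "k < u" "c < u"
    and eq: "(1 - m) * (k * (k - 1)) + 2 * q * k * (u - 1) = q * (q + 1) * c * (u - 1)"
  shows "k = u - 1"
proof -
  have qc: "q * c = k - s" using assms by simp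
  \<comment> \<open>The factor \<open>c\<close> turns \<open>c m\<close> into \<open>u\<close> and
    \<open>q c\<close> into \<open>k - s\<close>, which eliminates \<open>m\<close> and
    \<open>q\<close>.\<close>
  have "(1 - m) * c * (k * (k - 1)) + 2 * (q * c) * k * (u - 1) = (q * c) * (q * c + c) * (u - 1)"
    using arg_cong[OF eq, of "\<lambda>z. c * z"] by (simp add: algebra_simps)
  moreover have "(1 - m) * c = c - u" using assms by (simp add: algebra_simps)
  ultimately have "(c - u) * (k * (k - 1)) + 2 * (k - s) * k * (u - 1) = (k - s) * (k - s + c) * (u - 1)"
    unfolding qc by simp
  then have main: "(c - 1) * (k * (u - k)) = (u - 1) * (s * (c - s))"
    by (simp add: algebra_simps)
  have "c * q \<le> k" using assms by (simp add: mult.commute)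
  then have "c * q < c * m" using \<open>u = c * m\<close> \<open>k < u\<close> by linarith
  then have "q < m" using \<open>2 \<le> c\<close> by simp
  show ?thesis
  proof (cases "m = q + 1")
    case True
    then have d: "u - k = c - s" using assms by (simp add: algebra_simps)
    then have "(c - s) * ((c - 1) * k) = (c - s) * ((u - 1) * s)"
      using main unfolding d by (simp only: ac_simps)
    then have "(c - 1) * k = (u - 1) * s" using assms by simp
    moreover have "k = u - c + s" using d by simp
    ultimately have "(c - 1) * (u - c + s) = (u - 1) * s" by simp
    \<comment> \<open>As \<open>c < u\<close>, this gives \<open>s = c - 1\<close>, and so
      \<open>u - k = c - s = 1\<close>.\<close>
    then have "(c - 1 - s) * (u - c) = 0" by (simp add: algebra_simps)
    then show ?thesis using assms d by simp
  next
    case False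
    then have "c * (q + 2) \<le> c * m" using \<open>q < m\<close> assms by simp
    then have d: "c + 1 \<le> u - k" using assms by (simp add: algebra_simps)
    have "1 * c \<le> q * c" using assms by (intro mult_right_mono) auto
    moreover have "s \<noteq> 0"
      using main assms by auto
    ultimately have k: "c + 1 \<le> k" using \<open>k = q * c + s\<close> \<open>0 \<le> s\<close> by linarith
    \<comment> \<open>Both \<open>k\<close> and \<open>u - k\<close> are at least
      \<open>c + 1\<close>; expanding around this corner gives
      \<open>2 k (u - k) > c (u - 1)\<close>. Since \<open>2 s (c - s)\<close> is at most
      \<open>(c - 1) c\<close>, the left side of \<open>main\<close> is then too large.\<close>
    have "0 \<le> (k - c - 1) * (u - k - c - 1)" using d k by simp
    moreover have "0 \<le> (c + 2) * ((k - c - 1) + (u - k - c - 1))" using d k assms by simp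
    moreover have "2 * (k * (u - k)) - c * (u - 1) = 3 * c + 2
        + (c + 2) * ((k - c - 1) + (u - k - c - 1)) + 2 * ((k - c - 1) * (u - k - c - 1))"
      by (simp add: algebra_simps)
    ultimately have 1: "c * (u - 1) < 2 * (k * (u - k))" using assms by linarith
    have 2: "4 * (s * (c - s)) \<le> c * c"
      using zero_le_square[of "c - 2 * s"] by (simp add: algebra_simps)
    have "c * c \<le> (2 * (c - 1)) * c" using assms by (intro mult_right_mono) auto
    then have "c * c \<le> 2 * ((c - 1) * c)" by (simp only: mult.assoc)
    then have 3: "2 * (s * (c - s)) \<le> (c - 1) * c" using 2 by linarith
    have "2 * ((u - 1) * (s * (c - s))) \<le> (u - 1) * ((c - 1) * c)"
      using mult_left_mono[OF 3, of "u - 1"] assms by (simp add: algebra_simps)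
    also have "\<dots> < (c - 1) * (2 * (k * (u - k)))"
      using mult_strict_left_mono[OF 1, of "c - 1"] assms by (simp add: algebra_simps)
    finally show ?thesis using main by simp
  qed
qed

text \<open>The numbers \<open>i c + a\<close> with \<open>i < n div c\<close> give the lower bound.
  Division by \<open>c\<close> is injective on the class with values up to
  \<open>(n - 1) div c\<close>, which gives the upper one; its form is the one
  \<open>le_ceiling_iff\<close> asks for.\<close>

lemma card_residue_class_bounds:
  fixes n c a :: nat
  assumes "0 < c" "a < c"
  shows "n div c \<le> card {j. j < n \<and> j mod c = a}"
    and "0 < n \<Longrightarrow> real (card {j. j < n \<and> j mod c = a}) - 1 < real n / real c"
proof -
  let ?P = "{j. j < n \<and> j mod c = a}"
  have "(\<lambda>i. i * c + a) ` {..<n div c} \<subseteq> ?P"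
  proof safe
    fix i assume "i < n div c"
    then have "(i + 1) * c \<le> n div c * c" by (intro mult_right_mono) auto
    also have "\<dots> \<le> n" by simp
    finally show "i * c + a < n" using assms by simp
    show "(i * c + a) mod c = a" using assms by simp
  qed
  then have "card ((\<lambda>i. i * c + a) ` {..<n div c}) \<le> card ?P"
    by (intro card_mono) auto
  moreover have "inj_on (\<lambda>i. i * c + a) {..<n div c}" using assms by (auto simp: inj_on_def)
  ultimately show "n div c \<le> card ?P" by (simp add: card_image)
  show "real (card ?P) - 1 < real n / real c" if "0 < n"
  proof -
    have "inj_on (\<lambda>j. j div c) ?P"
      by (auto simp: inj_on_def) (metis div_mult_mod_eq)
    then have "card ?P = card ((\<lambda>j. j div c) ` ?P)" by (simp add: card_image)
    also have "\<dots> \<le> card {..(n - 1) div c}"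
      by (intro card_mono) (auto intro: div_le_mono)
    finally have "card ?P - 1 \<le> (n - 1) div c" by simp
    then have "(card ?P - 1) * c \<le> (n - 1) div c * c" by (rule mult_right_mono) simp
    also have "\<dots> \<le> n - 1" by simp
    finally have "(card ?P - 1) * c < n" using that by simp
    then have "real (card ?P - 1) * real c < real n" by (metis of_nat_less_iff of_nat_mult)
    moreover have "(real (card ?P) - 1) * real c \<le> real (card ?P - 1) * real c"
      by (intro mult_right_mono) auto
    ultimately show ?thesis using assms by (simp add: field_simps)
  qed
qed


section \<open>Colourings: necessity of the conditions, then the construction\<close>

context gdd
begin

lemma equitable_colouring_imp:
  assumes "block_equitable_colouring k c V \<B> C f" "2 \<le> c" "c < u" "k < u"
  shows "k = u - 1 \<and> c dvd u"
proof -
  define q where "q = k div c"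
  define F where "F = colour_class V f"
  have fC: "finite C" "card C = c" "\<And>x. x \<in> V \<Longrightarrow> f x \<in> C"
    using assms(1) by (auto simp: block_equitable_colouring_def colouring_def)
  have FV: "F \<gamma> \<subseteq> V" for \<gamma> by (auto simp: F_def colour_class_def)
  have bnd: "q \<le> card (B \<inter> F \<gamma>)" "card (B \<inter> F \<gamma>) \<le> q + 1" if "\<gamma> \<in> C" "B \<in> \<B>" for \<gamma> B
  proof -
    have "\<lfloor>real k / real c\<rfloor> \<le> int (card (B \<inter> F \<gamma>))" "int (card (B \<inter> F \<gamma>)) \<le> \<lceil>real k / real c\<rceil>"
      using assms(1) that by (auto simp: block_equitable_colouring_def F_def)
    moreover have "\<lfloor>real k / real c\<rfloor> = int q" by (simp add: q_def floor_divide_of_nat_eq)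
    moreover have "\<lceil>real k / real c\<rceil> \<le> \<lfloor>real k / real c\<rfloor> + 1" by linarith
    ultimately show "q \<le> card (B \<inter> F \<gamma>)" "card (B \<inter> F \<gamma>) \<le> q + 1" by linarith+
  qed
  \<comment> \<open>If \<open>q = 0\<close>, a block meets each class at most once, so each class
    lies in one group. Representatives of distinct groups then have distinct colours, against
    \<open>c < u\<close>.\<close>
  have "1 \<le> q"
  proof (rule ccontr)
    assume "\<not> 1 \<le> q"
    then have "q = 0" by simp
    define p where "p G = (SOME x. x \<in> G)" for G :: "'a set"
    have p: "p G \<in> G" if "G \<in> \<G>" for G
      using that card_group[OF that] g_pos unfolding p_def
      by (metis card.empty less_irrefl some_in_eq)
    then have pV: "p G \<in> V" "group_of (p G) = G" if "G \<in> \<G>" for G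
      using that group_subset group_of_eq by blast+
    have "inj_on (\<lambda>G. f (p G)) \<G>"
    proof (rule inj_onI)
      fix G H assume GH: "G \<in> \<G>" "H \<in> \<G>" and eq: "f (p G) = f (p H)"
      define \<gamma> where "\<gamma> = f (p G)"
      have "p G \<in> F \<gamma>" "p H \<in> F \<gamma>" "\<gamma> \<in> C"
        using eq pV GH fC by (auto simp: F_def colour_class_def \<gamma>_def)
      then have "card (F \<gamma> - group_of (p G)) \<le> 0"
        using card_Diff_group_of_le[OF FV, of "p G" \<gamma> 0] bnd \<open>q = 0\<close> by auto
      moreover have "finite (F \<gamma> - group_of (p G))"
        using FV finite_V finite_subset by blast
      ultimately have "F \<gamma> \<subseteq> G" using pV GH by simp
      then have "p H \<in> G" using \<open>p H \<in> F \<gamma>\<close> by auto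
      then show "G = H" using group_of_eq[of G "p H"] pV GH by simp
    qed
    then have "card \<G> \<le> card C"
      using fC pV by (intro card_inj_on_le[of "\<lambda>G. f (p G)"]) auto
    then show False using fC card_groups assms by simp
  qed
  have "2 * q \<le> c * q" using assms by simp
  also have "\<dots> \<le> k" unfolding q_def by simp
  finally have "q + 1 < k" using k_ge_3 by linarith
  note struct = union_of_groups[OF FV bnd \<open>1 \<le> q\<close> \<open>q + 1 < k\<close> \<open>k < u\<close>]
  define m where "m \<gamma> = card {G \<in> \<G>. G \<subseteq> F \<gamma>}" for \<gamma>
  have N: "card (F \<gamma>) = g * m \<gamma>" if "\<gamma> \<in> C" for \<gamma>
    using struct(1)[of \<gamma>] that by (simp add: m_def)
  have ex: "(int g * int (m \<gamma>) - int q * int r) * (int g - (int g * int (m \<gamma>) - int q * int r)) = excess q"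
    if "\<gamma> \<in> C" for \<gamma>
    using struct(2)[of \<gamma>] that N[OF that] by simp
  have w: "0 < int g * int (m \<gamma>) - int q * int r" "int g * int (m \<gamma>) - int q * int r < int g"
    if "\<gamma> \<in> C" for \<gamma>
  proof -
    define x where "x = int g * int (m \<gamma>) - int q * int r"
    have "0 < x * (int g - x)"
      using ex[OF that] excess_pos[OF \<open>1 \<le> q\<close> \<open>q + 1 < k\<close> \<open>k < u\<close>] by (simp add: x_def)
    \<comment> \<open>The factors have the nonnegative sum \<open>g\<close>, so they are not both
      negative.\<close>
    then have "0 < x \<and> x < int g" unfolding zero_less_mult_iff by linarith
    then show "0 < int g * int (m \<gamma>) - int q * int r"
      "int g * int (m \<gamma>) - int q * int r < int g" by (simp_all add: x_def)
  qed
  have le: "m \<gamma> \<le> m \<delta>" if "\<gamma> \<in> C" "\<delta> \<in> C" for \<gamma> \<delta>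
  proof -
    \<comment> \<open>The open interval from \<open>q r\<close> to \<open>q r + g\<close> contains
      at most one multiple of \<open>g\<close>, so all classes consist of equally many
      groups.\<close>
    have "int g * int (m \<gamma>) < int g * (int (m \<delta>) + 1)"
      using w[OF that(1)] w[OF that(2)] by (simp add: algebra_simps)
    then show ?thesis using g_pos by simp
  qed
  obtain \<gamma>\<^sub>0 where \<gamma>\<^sub>0: "\<gamma>\<^sub>0 \<in> C" using fC assms by fastforce
  define M where "M = m \<gamma>\<^sub>0"
  have mM: "m \<gamma> = M" if "\<gamma> \<in> C" for \<gamma> using le that \<gamma>\<^sub>0 M_def by (simp add: antisym)
  have "V = (\<Union>\<gamma>\<in>C. F \<gamma>)" using fC by (auto simp: F_def colour_class_def)
  then have "card V = card (\<Union>\<gamma>\<in>C. F \<gamma>)" by simp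
  also have "\<dots> = (\<Sum>\<gamma>\<in>C. card (F \<gamma>))"
    using fC FV finite_V finite_subset
    by (intro card_UN_disjoint) (auto simp: F_def colour_class_def)
  also have "\<dots> = c * (g * M)" using N mM fC by simp
  finally have u: "u = c * M" using card_V g_pos by simp
  have M_pos: "0 < M" using u assms by (cases M) auto
  have "int k = int u - 1"
  proof (rule class_size_equation_imp[of "int q" "int c" "int (k mod c)" "int k" "int u" "int M"])
    show "int k = int q * int c + int (k mod c)"
      by (simp add: q_def flip: of_nat_mult of_nat_add)
    have r: "int r * (int k - 1) = int g * (int u - 1)"
      using arg_cong[OF r_times, of int] assms k_ge_3 by (simp add: of_nat_diff)
    have b: "int (card \<B>) * int k = int r * (int g * int u)"
      using card_blocks_times by (metis of_nat_mult)
    let ?L = "(1 - int M) * (int k * (int k - 1)) + 2 * int q * int k * (int u - 1)"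
    let ?R = "int q * (int q + 1) * int c * (int u - 1)"
    \<comment> \<open>This is \<open>w (g - w) = excess q\<close> with the common terms cancelled.
      Multiplying by \<open>k (k - 1)\<close> removes the number of blocks and \<open>r\<close>, and
      \<open>u = c M\<close> lets \<open>g g M\<close> cancel.\<close>
    have "int g * int g * int M * (1 - int M) + 2 * int g * int M * int q * int r
        = int (card \<B>) * (int q * (int q + 1))"
      using ex[OF \<gamma>\<^sub>0] unfolding excess_def M_def[symmetric]
      by (simp add: algebra_simps power2_eq_square)
    then have "int k * (int k - 1) * (int g * int g * int M * (1 - int M) + 2 * int g * int M * int q * int r)
        = int k * (int k - 1) * (int (card \<B>) * (int q * (int q + 1)))" by simp
    then have "int g * int g * int M * (1 - int M) * (int k * (int k - 1))
        + 2 * int g * int M * int q * int k * (int r * (int k - 1))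
        = (int (card \<B>) * int k) * (int k - 1) * (int q * (int q + 1))"
      by (simp only: algebra_simps)
    also have "\<dots> = (int r * (int k - 1)) * (int g * int u) * (int q * (int q + 1))"
      unfolding b by (simp only: ac_simps)
    finally have "(int g * int g * int M) * ?L = (int g * (int u - 1)) * (int g * int u) * (int q * (int q + 1))"
      unfolding r by (simp only: algebra_simps)
    also have "\<dots> = (int g * (int u - 1)) * (int g * (int c * int M)) * (int q * (int q + 1))"
      using u by simp
    also have "\<dots> = (int g * int g * int M) * ?R" by (simp only: ac_simps)
    finally show "?L = ?R" using g_pos M_pos by simp
    show "int k < int u" "int c < int u" using assms by simp_all
  qed (use assms \<open>1 \<le> q\<close> u in auto)
  then have "k = u - 1" by linarith
  moreover have "c dvd u" using u by simp
  ultimately show ?thesis ..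
qed

text \<open>Groups are numbered and coloured by residues modulo \<open>c\<close>, so only the set of
  group numbers met by a block matters, and this set is nearly all of \<open>{0..<u}\<close> unless
  \<open>u \<le> c\<close>.\<close>

lemma equitable_colouring_if:
  assumes "2 \<le> c" "k \<le> u"
    and cases: "u \<le> c \<or> k = u \<or> (k = u - 1 \<and> c dvd u)"
  shows "has_block_equitable_colouring k c V \<B>"
proof -
  obtain e where e: "bij_betw e \<G> {0..<u}"
    using ex_bij_betw_finite_nat[OF finite_groups] card_groups by auto
  define f where "f x = e (group_of x) mod c" for x
  have bnds: "\<lfloor>real k / real c\<rfloor> \<le> int (card (B \<inter> colour_class V f \<gamma>)) \<and>
        int (card (B \<inter> colour_class V f \<gamma>)) \<le> \<lceil>real k / real c\<rceil>"
    if "\<gamma> < c" "B \<in> \<B>" for \<gamma> B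
  proof -
    let ?P = "{j. j < u \<and> j mod c = \<gamma>}"
    \<comment> \<open>A block meets each group at most once, so \<open>J\<close> has
      \<open>k\<close> elements and its residue counts are the colour counts of
      \<open>B\<close>.\<close>
    define J where "J = (\<lambda>x. e (group_of x)) ` B"
    have "group_of ` B \<subseteq> \<G>" using block_subset[OF that(2)] group_of_in_groups by blast
    then have inj: "inj_on (\<lambda>x. e (group_of x)) B"
      using comp_inj_on[OF inj_on_group_of_block[OF that(2)], of e] e
      by (auto simp: bij_betw_def comp_def intro: inj_on_subset)
    have J: "J \<subseteq> {0..<u}" "card J = k"
      using \<open>group_of ` B \<subseteq> \<G>\<close> e card_image[OF inj] card_block[OF that(2)]
      by (auto simp: J_def bij_betw_def)
    have "{j \<in> J. j mod c = \<gamma>} = (\<lambda>x. e (group_of x)) ` (B \<inter> colour_class V f \<gamma>)"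
      using block_subset[OF that(2)] by (auto simp: J_def colour_class_def f_def)
    then have n: "card (B \<inter> colour_class V f \<gamma>) = card {j \<in> J. j mod c = \<gamma>}"
      using inj by (metis card_image inf_le1 inj_on_subset)
    have c: "0 < c" "0 < u" using assms k_ge_3 by auto
    have P: "u div c \<le> card ?P" "real (card ?P) - 1 < real u / real c"
      using card_residue_class_bounds[OF c(1) that(1), of u] c by auto
    have "{j \<in> J. j mod c = \<gamma>} \<subseteq> ?P" using J by auto
    then have nP: "card {j \<in> J. j mod c = \<gamma>} \<le> card ?P" by (intro card_mono) auto
    have full: "k div c \<le> card {j \<in> J. j mod c = \<gamma>} \<and>
        real (card {j \<in> J. j mod c = \<gamma>}) - 1 < real k / real c" if "k = u"
    proof -
      have "J = {0..<u}" using J that by (intro card_subset_eq) auto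
      then have "{j \<in> J. j mod c = \<gamma>} = ?P" by auto
      then show ?thesis using P that by simp
    qed
    have "k div c \<le> card {j \<in> J. j mod c = \<gamma>} \<and>
        real (card {j \<in> J. j mod c = \<gamma>}) - 1 < real k / real c"
      using cases
    proof (elim disjE conjE)
      assume "k = u"
      then show ?thesis by (rule full)
    next
      assume k: "k = u - 1" "c dvd u"
      then obtain m where m: "u = c * m" by blast
      \<comment> \<open>The block misses one number only, so it contains \<open>m - 1\<close> or
        \<open>m\<close> numbers of each residue; these are the floor and the ceiling of
        \<open>(c m - 1) / c\<close>.\<close>
      have "card ({0..<u} - J) = 1"
        using J k c by (subst card_Diff_subset) (auto intro: finite_subset)
      then obtain z where z: "{0..<u} - J = {z}" by (auto simp: card_1_singleton_iff)
      have "?P \<subseteq> insert z {j \<in> J. j mod c = \<gamma>}"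
      proof
        fix j assume j: "j \<in> ?P"
        then have "j \<in> J \<or> j \<in> {z}" unfolding z[symmetric] by simp
        then show "j \<in> insert z {j \<in> J. j mod c = \<gamma>}" using j by blast
      qed
      then have "card ?P \<le> card (insert z {j \<in> J. j mod c = \<gamma>})"
        using finite_subset[OF J(1)] by (intro card_mono) auto
      also have "\<dots> \<le> card {j \<in> J. j mod c = \<gamma>} + 1"
        by (simp add: card_insert_le_m1)
      finally have ge: "m \<le> card {j \<in> J. j mod c = \<gamma>} + 1" using P m c by simp
      have "k < m * c" using k c m by (simp add: mult.commute)
      then have "k div c < m" by (simp add: less_mult_imp_div_less)
      then have 1: "k div c \<le> card {j \<in> J. j mod c = \<gamma>}" using ge by linarith
      have "real (card ?P) - 1 < real m" using P m c by simp
      then have "card ?P < m + 1" by linarith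
      then have "real (card {j \<in> J. j mod c = \<gamma>}) \<le> real m" using nP by linarith
      moreover have "real m - 1 < real k / real c"
      proof -
        have "(real m - 1) * real c < real k"
          using assms(1) k c m by (simp add: of_nat_diff algebra_simps)
        then show ?thesis using c by (simp add: field_simps)
      qed
      ultimately show ?thesis using 1 by linarith
    next
      assume "u \<le> c"
      show ?thesis
      \<comment> \<open>For \<open>k = u = c\<close> the floor is 1, so \<open>k = u\<close> is
        treated apart; otherwise \<open>k < c\<close> and a residue class has at most one
        member.\<close>
      proof (cases "k = u")
        case True
        then show ?thesis by (rule full)
      next
        case False
        then have "k div c = 0" using assms \<open>u \<le> c\<close> by simp
        moreover have "real u / real c \<le> 1" using \<open>u \<le> c\<close> c by simp
        then have "card ?P < 2" using P by linarith
        then have "real (card {j \<in> J. j mod c = \<gamma>}) - 1 \<le> 0" using nP by linarith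
        moreover have "0 < real k / real c" using k_ge_3 c by simp
        ultimately show ?thesis by simp
      qed
    qed
    then show ?thesis
      unfolding n by (simp add: floor_divide_of_nat_eq le_ceiling_iff)
  qed
  have "block_equitable_colouring k c V \<B> {..<c} f"
    using bnds assms by (auto simp: block_equitable_colouring_def colouring_def f_def)
  then show ?thesis unfolding has_block_equitable_colouring_def by blast
qed

end

text \<open>Since empty colour classes are allowed, colourings also exist for
  \<open>c > u * g\<close>, where (i) fails; therefore \<open>c \<le> u * g\<close> is a
  hypothesis.\<close>

theorem theorem2p6:
  fixes k g u c :: nat and V :: "'a set" and \<G> \<B> :: "'a set set"
  assumes "0 < k" and "0 < g" and "0 < u" and "0 < c"
    and "2 \<le> c" and "c \<le> u * g"
    and "k_GDD_of_type k g u V \<G> \<B>"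
    and "3 \<le> k" and "k \<le> u"
  shows "has_block_equitable_colouring k c V \<B> \<longleftrightarrow>
    (u \<le> c \<and> c \<le> u * g) \<or> k = u \<or> (k = u - 1 \<and> c dvd u)"
proof -
  interpret gdd k g u V \<G> \<B>
    using assms by unfold_locales
  show ?thesis
    using equitable_colouring_imp[of c] equitable_colouring_if[of c] assms
    unfolding has_block_equitable_colouring_def by (metis le_neq_implies_less not_less)
qed

end
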